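(* Let $n\ge 2$ and let $d\ge 2$ be even. Then the volume function $f:\mathcal{C}_{d,n}\to\mathbb{R}$, $f(g)=\mathrm{vol}(\{\mathbf{x}\in\mathbb{R}^n: g(\mathbf{x})\le 1\})$, admits the integral representation $$f(g)\;=\;\int_{\mathcal{C}_{d,n}^{*}}\exp(-\langle\theta,g\rangle)\,\frac{\mathrm{d}\mu(\theta)}{\Gamma(1+n/d)},\qquad g\in\mathcal{C}_{d,n},$$ where $\mu$ is the push-forward of the Lebesgue measure on $\mathbb{R}^n$ under the Veronese map $\boldsymbol{\Theta}_{d,n}$. In particular, $f:\mathcal{C}_{d,n}\to\mathbb{R}$ is completely monotone, and for all $k\in\mathbb{N}$ and $v_1,\dots,v_k\in\mathcal{C}_{d,n}$ we have $$(-1)^kD_{v_1}\cdots D_{v_k}f(g)\;\ge\;0,\qquad g\in\mathcal{C}_{d,n}.$$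
   Context: $\mathcal{H}_{d,n}$ is the space of real $n$-variate forms (homogeneous polynomials) of degree $d$, endowed with the Bombieri inner product $\langle g,h\rangle=\sum_{|\alpha|=d}\binom{d}{\alpha}^{-1}g_\alpha h_\alpha$, $\binom{d}{\alpha}=\frac{d!}{\alpha_1!\cdots\alpha_n!}$, for $g=\sum_{|\alpha|=d}g_\alpha\mathbf{x}^\alpha$ and $h=\sum_{|\alpha|=d}h_\alpha\mathbf{x}^\alpha$. $\mathcal{C}_{d,n}\subset\mathcal{H}_{d,n}$ is the open convex cone of positive definite forms, i.e. forms that are strictly positive on $\mathbb{R}^n\setminus\{\mathbf{0}\}$. $\mathrm{vol}$ denotes the Lebesgue volume. The dual cone is $\mathcal{C}_{d,n}^{*}=\{L\in\mathcal{H}_{d,n}^*: L(g)\ge 0\ \forall g\in\mathcal{C}_{d,n}\}$; via the Bombieri inner product $\mathcal{H}_{d,n}^*$ is identified with $\mathcal{H}_{d,n}$, so that $\theta\in\mathcal{C}_{d,n}^*$ acts by $g\mapsto\langle\theta,g\rangle$. The Veronese map $\boldsymbol{\Theta}_{d,n}:\mathbb{R}^n\to\mathcal{C}_{d,n}^{*}$ sends $\boldsymbol{\ell}\in\mathbb{R}^n$ to the evaluation functional $[g\mapsto g(\boldsymbol{\ell})]$, which under the identification is the form $\theta_{\boldsymbol{\ell}}(\mathbf{x})=(\boldsymbol{\ell}^{\mathsf T}\mathbf{x})^d$. $D_v$ denotes the directional derivative along $v$. A function $F:C\to\mathbb{R}$ on an open convex cone $C$ of a finite-dimensional real vector space is completely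 monotone if it is $C^\infty$ and $(-1)^kD_{v_1}\cdots D_{v_k}F\ge 0$ on $C$ for all $k\in\mathbb{N}$ and all $v_1,\dots,v_k\in C$. *)

theory Defs
  imports "HOL-Analysis.Analysis"
begin

text \<open>The numbers of variables and the degree are carried by types: $n$ is \<open>CARD('n)\<close> and $d$
  is \<open>CARD('d)\<close>. A form is represented by its coefficients in the monomial basis, which makes
  $\mathcal{H}_{d,n}$ a Euclidean space with the usual topology, Borel sets and derivatives. The
  inner product \<open>\<bullet>\<close> of that type is the plain one on coefficients, not the Bombieri product.\<close>

typedef ('n, 'd) multi_index = "{a :: 'n::finite \<Rightarrow> nat. (\<Sum>i\<in>UNIV. a i) = CARD('d)}"
  morphisms exponent Multi_index
proof
  fix j :: 'n
  show "(\<lambda>i. if i = j then CARD('d) else 0) \<in> {a. (\<Sum>i\<in>UNIV. a i) = CARD('d)}"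
    by simp
qed

lemma sum_exponent: "(\<Sum>i\<in>UNIV. exponent (\<alpha> :: ('n::finite, 'd) multi_index) i) = CARD('d)"
  using exponent[of \<alpha>] by simp

instance multi_index :: (finite, type) finite
proof
  let ?S = "{a :: 'a \<Rightarrow> nat. (\<Sum>i\<in>UNIV. a i) = CARD('b)}"
  have "?S \<subseteq> PiE UNIV (\<lambda>_. {..CARD('b)})"
  proof (intro subsetI PiE_I)
    fix a :: "'a \<Rightarrow> nat" and i :: 'a
    assume "a \<in> ?S"
    then show "a i \<in> {..CARD('b)}"
      using member_le_sum[of i UNIV a] by simp
  qed simp
  then have "finite ?S"
    by (rule finite_subset) (simp add: finite_PiE)
  moreover have "(UNIV :: ('a, 'b) multi_index set) = Multi_index ` ?S"
    using type_definition.Abs_image[OF type_definition_multi_index] by (rule sym)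
  ultimately show "finite (UNIV :: ('a, 'b) multi_index set)"
    by (metis finite_imageI)
qed

type_synonym ('n, 'd) form = "real ^ ('n, 'd) multi_index"

definition form_eval :: "('n::finite, 'd) form \<Rightarrow> real ^ 'n \<Rightarrow> real" where
  "form_eval g x = (\<Sum>\<alpha>\<in>UNIV. g $ \<alpha> * (\<Prod>i\<in>UNIV. (x $ i) ^ exponent \<alpha> i))"

definition multinomial :: "('n::finite, 'd) multi_index \<Rightarrow> real" where
  "multinomial \<alpha> = fact (CARD('d)) / (\<Prod>i\<in>UNIV. fact (exponent \<alpha> i))"

definition bombieri :: "('n::finite, 'd) form \<Rightarrow> ('n, 'd) form \<Rightarrow> real" where
  "bombieri g h = (\<Sum>\<alpha>\<in>UNIV. g $ \<alpha> * h $ \<alpha> / multinomial \<alpha>)"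

definition posdef_forms :: "('n::finite, 'd) form set" where
  "posdef_forms = {g. \<forall>x. x \<noteq> 0 \<longrightarrow> form_eval g x > 0}"

text \<open>The dual cone, with linear functionals identified with forms via the Bombieri product.\<close>

definition dual_cone :: "('n::finite, 'd) form set" where
  "dual_cone = {\<theta>. \<forall>g\<in>posdef_forms. bombieri \<theta> g \<ge> 0}"

text \<open>The coefficients of $(\ell^{\mathsf T} x)^d$, expanded by the multinomial theorem. The lemmas
  \<open>form_eval_veronese\<close> and \<open>bombieri_veronese\<close> below show that this is the form
  $(\ell^{\mathsf T} x)^d$ and that it represents evaluation at $\ell$.\<close>

definition veronese :: "real ^ 'n::finite \<Rightarrow> ('n, 'd) form" where
  "veronese l = (\<chi> \<alpha>. multinomial \<alpha> * (\<Prod>i\<in>UNIV. (l $ i) ^ exponent \<alpha> i))"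

definition veronese_measure :: "('n::finite, 'd) form measure" where
  "veronese_measure = distr lborel borel veronese"

definition sublevel :: "('n::finite, 'd) form \<Rightarrow> (real ^ 'n) set" where
  "sublevel g = {x. form_eval g x \<le> 1}"

definition sublevel_volume :: "('n::finite, 'd) form \<Rightarrow> real" where
  "sublevel_volume g = measure lborel (sublevel g)"

definition dir_deriv :: "'a::real_normed_vector \<Rightarrow> ('a \<Rightarrow> real) \<Rightarrow> 'a \<Rightarrow> real" where
  "dir_deriv v F x = deriv (\<lambda>t. F (x + t *\<^sub>R v)) 0"

text \<open>\<open>dir_derivs [v1, \<dots>, vk] F\<close> is $D_{v_1} \cdots D_{v_k} F$.\<close>

definition dir_derivs :: "'a::real_normed_vector list \<Rightarrow> ('a \<Rightarrow> real) \<Rightarrow> 'a \<Rightarrow> real" where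
  "dir_derivs vs F = foldr dir_deriv vs F"

text \<open>\<open>Ck_on k S F\<close> is $F \in C^k(S)$, for \<open>S\<close> open in a finite-dimensional space.\<close>

primrec Ck_on :: "nat \<Rightarrow> 'a::euclidean_space set \<Rightarrow> ('a \<Rightarrow> real) \<Rightarrow> bool" where
  "Ck_on 0 S F \<longleftrightarrow> continuous_on S F"
| "Ck_on (Suc k) S F \<longleftrightarrow> (\<forall>x\<in>S. F differentiable (at x)) \<and>
     (\<forall>v. Ck_on k S (\<lambda>x. frechet_derivative F (at x) v))"

text \<open>To be used for an open convex cone \<open>C\<close>; \<open>posdef_forms\<close> is one by the lemmas below.\<close>

definition completely_monotone_on :: "'a::euclidean_space set \<Rightarrow> ('a \<Rightarrow> real) \<Rightarrow> bool" where
  "completely_monotone_on C F \<longleftrightarrow> (\<forall>k. Ck_on k C F) \<and>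
     (\<forall>vs. set vs \<subseteq> C \<longrightarrow> (\<forall>x\<in>C. (- 1) ^ length vs * dir_derivs vs F x \<ge> 0))"

lemma multinomial_pos: "multinomial \<alpha> > 0"
  unfolding multinomial_def by (intro divide_pos_pos prod_pos) auto

lemma bombieri_veronese: "bombieri (veronese l) g = form_eval g l"
proof -
  have "multinomial \<alpha> \<noteq> 0" for \<alpha> :: "('a, 'b) multi_index"
    using multinomial_pos[of \<alpha>] by simp
  then show ?thesis
    by (simp add: bombieri_def veronese_def form_eval_def mult.commute)
qed

lemma multinomial_theorem:
  fixes a :: "'n \<Rightarrow> real"
  assumes "finite A"
  shows "(\<Sum>i\<in>A. a i) ^ d =
    (\<Sum>e\<in>{e. (\<forall>i. i \<notin> A \<longrightarrow> e i = 0) \<and> (\<Sum>i\<in>A. e i) = d}.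
      fact d / (\<Prod>i\<in>A. fact (e i)) * (\<Prod>i\<in>A. a i ^ e i))"
  using assms
proof (induction A arbitrary: d rule: finite_induct)
  case empty
  show ?case
  proof (cases "d = 0")
    case True
    then have "{e :: 'n \<Rightarrow> nat. (\<forall>i. i \<notin> {} \<longrightarrow> e i = 0) \<and> (\<Sum>i\<in>{}. e i) = d} = {\<lambda>_. 0}"
      by auto
    then show ?thesis using True by simp
  qed auto
next
  case (insert j A)
  let ?E = "\<lambda>B d. {e :: 'n \<Rightarrow> nat. (\<forall>i. i \<notin> B \<longrightarrow> e i = 0) \<and> (\<Sum>i\<in>B. e i) = d}"
  let ?t = "\<lambda>B d e. fact d / (\<Prod>i\<in>B. fact (e i)) * (\<Prod>i\<in>B. a i ^ e i) :: real"
  have fin: "finite (?E B m)" if "finite B" for B m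
  proof -
    have "?E B m \<subseteq> {e. \<forall>i. (i \<in> B \<longrightarrow> e i \<in> {..m}) \<and> (i \<notin> B \<longrightarrow> e i = 0)}"
    proof (intro subsetI CollectI allI conjI impI)
      fix e i assume e: "e \<in> ?E B m"
      show "e i \<in> {..m}" if "i \<in> B"
        using member_le_sum[OF that, of e] e \<open>finite B\<close> by auto
      show "e i = 0" if "i \<notin> B"
        using e that by blast
    qed
    then show ?thesis
      using finite_set_of_finite_funs[OF that, of "{..m}" 0] finite_subset by blast
  qed
  have upd: "(\<Sum>i\<in>A. (e(j := k)) i) = (\<Sum>i\<in>A. e i)" for e :: "'n \<Rightarrow> nat" and k
    using insert.hyps by (intro sum.cong) auto
  have "(\<Sum>i\<in>insert j A. a i) ^ d = (\<Sum>k\<le>d. (d choose k) * a j ^ k * (\<Sum>i\<in>A. a i) ^ (d - k))"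
    using insert.hyps by (simp add: binomial_ring)
  also have "\<dots> = (\<Sum>k\<le>d. \<Sum>e\<in>?E A (d - k). (d choose k) * a j ^ k * ?t A (d - k) e)"
    by (simp only: insert.IH sum_distrib_left)
  also have "\<dots> = (\<Sum>(k, e)\<in>(SIGMA k:{..d}. ?E A (d - k)). (d choose k) * a j ^ k * ?t A (d - k) e)"
    using fin[OF insert.hyps(1)] by (intro sum.Sigma) auto
  also have "\<dots> = (\<Sum>e\<in>?E (insert j A) d. ?t (insert j A) d e)"
  proof (rule sum.reindex_bij_witness[where j = "\<lambda>(k, e). e(j := k)" and i = "\<lambda>e. (e j, e(j := 0))"])
    fix p assume p: "p \<in> (SIGMA k:{..d}. ?E A (d - k))"
    obtain k e where pe: "p = (k, e)" by fastforce
    have k: "k \<le> d" and e: "\<forall>i. i \<notin> A \<longrightarrow> e i = 0" "(\<Sum>i\<in>A. e i) = d - k"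
      using p pe by auto
    have "e j = 0" using e insert.hyps by auto
    then show "((case p of (k, e) \<Rightarrow> e(j := k)) j, (case p of (k, e) \<Rightarrow> e(j := k))(j := 0)) = p"
      using pe by (auto simp: fun_eq_iff)
    show "(case p of (k, e) \<Rightarrow> e(j := k)) \<in> ?E (insert j A) d"
      unfolding pe prod.case mem_Collect_eq sum.insert[OF insert.hyps] upd
      using k e by auto
    have 1: "(\<Prod>i\<in>A. fact ((e(j := k)) i) :: real) = (\<Prod>i\<in>A. fact (e i))"
      using insert.hyps by (intro prod.cong) auto
    have 2: "(\<Prod>i\<in>A. a i ^ (e(j := k)) i) = (\<Prod>i\<in>A. a i ^ e i)"
      using insert.hyps by (intro prod.cong) auto
    have 3: "real (d choose k) = fact d / (fact k * fact (d - k))"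
      using k by (rule binomial_fact)
    show "?t (insert j A) d (case p of (k, e) \<Rightarrow> e(j := k)) =
        (case p of (k, e) \<Rightarrow> (d choose k) * a j ^ k * ?t A (d - k) e)"
      unfolding pe prod.case prod.insert[OF insert.hyps] 1 2 3 fun_upd_same
      by simp
  next
    fix e assume e: "e \<in> ?E (insert j A) d"
    then show "(case (e j, e(j := 0)) of (k, e) \<Rightarrow> e(j := k)) = e"
      by simp
    show "(e j, e(j := 0)) \<in> (SIGMA k:{..d}. ?E A (d - k))"
      unfolding mem_Sigma_iff mem_Collect_eq upd
      using e by (auto simp: sum.insert[OF insert.hyps])
  qed
  finally show ?case .
qed

lemma form_eval_veronese:
  "form_eval (veronese l :: ('n::finite, 'd) form) x = (l \<bullet> x) ^ CARD('d)"
proof -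
  let ?E = "{e :: 'n \<Rightarrow> nat. (\<Sum>i\<in>UNIV. e i) = CARD('d)}"
  let ?t = "\<lambda>e. fact (CARD('d)) / (\<Prod>i\<in>UNIV. fact (e i)) * (\<Prod>i\<in>UNIV. (l $ i * x $ i) ^ e i) :: real"
  have "bij_betw exponent (UNIV :: ('n, 'd) multi_index set) ?E"
    using type_definition.Rep_range[OF type_definition_multi_index]
    by (auto simp: bij_betw_def inj_on_def exponent_inject)
  then have "(\<Sum>\<alpha>\<in>(UNIV :: ('n, 'd) multi_index set). ?t (exponent \<alpha>)) = (\<Sum>e\<in>?E. ?t e)"
    by (rule sum.reindex_bij_betw)
  moreover have "(l \<bullet> x) ^ CARD('d) = (\<Sum>e\<in>?E. ?t e)"
    using multinomial_theorem[of UNIV "\<lambda>i. l $ i * x $ i" "CARD('d)"]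
    by (simp add: inner_vec_def)
  ultimately show ?thesis
    by (simp add: form_eval_def veronese_def multinomial_def power_mult_distrib prod.distrib mult_ac)
qed

lemma form_eval_add: "form_eval (g + h) x = form_eval g x + form_eval h x"
  by (simp add: form_eval_def sum.distrib distrib_right)

lemma form_eval_scaleR: "form_eval (c *\<^sub>R g) x = c * form_eval g x"
  by (simp add: form_eval_def sum_distrib_left mult_ac)

lemma form_eval_homogeneous:
  "form_eval (g :: ('n::finite, 'd) form) (c *\<^sub>R x) = c ^ CARD('d) * form_eval g x"
proof -
  have "(\<Prod>i\<in>UNIV. (c * x $ i) ^ exponent (\<alpha> :: ('n, 'd) multi_index) i) =
      c ^ CARD('d) * (\<Prod>i\<in>UNIV. (x $ i) ^ exponent \<alpha> i)" for \<alpha>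
    by (simp add: power_mult_distrib prod.distrib power_sum[symmetric] sum_exponent)
  then show ?thesis
    by (simp add: form_eval_def sum_distrib_left mult_ac)
qed

lemma convex_posdef_forms: "convex posdef_forms"
proof (rule convexI)
  fix g h :: "('a, 'b) form" and u v :: real
  assume "g \<in> posdef_forms" "h \<in> posdef_forms" "0 \<le> u" "0 \<le> v" "u + v = 1"
  then show "u *\<^sub>R g + v *\<^sub>R h \<in> posdef_forms"
    by (cases "u = 0")
      (auto simp: posdef_forms_def form_eval_add form_eval_scaleR intro!: add_pos_nonneg mult_nonneg_nonneg
        dest: less_imp_le)
qed

lemma scaleR_posdef_forms: "c > 0 \<Longrightarrow> g \<in> posdef_forms \<Longrightarrow> c *\<^sub>R g \<in> posdef_forms"
  by (simp add: posdef_forms_def form_eval_scaleR)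

lemma open_posdef_forms: "open (posdef_forms :: ('n::finite, 'd) form set)"
proof (subst open_dist, intro ballI)
  fix g :: "('n, 'd) form"
  assume g: "g \<in> posdef_forms"
  let ?S = "sphere (0 :: real ^ 'n) 1"
  have cont: "continuous_on ?S (form_eval g)"
    unfolding form_eval_def by (intro continuous_intros)
  have ne: "?S \<noteq> {}"
    by simp
  obtain x0 where x0: "x0 \<in> ?S" "\<And>x. x \<in> ?S \<Longrightarrow> form_eval g x0 \<le> form_eval g x"
    using continuous_attains_inf[OF compact_sphere ne cont] by blast
  define m where "m = form_eval g x0"
  have m: "m > 0"
  proof -
    have "x0 \<noteq> 0" using x0(1) by auto
    then show ?thesis using g unfolding m_def posdef_forms_def by auto
  qed
  define K where "K = real (CARD(('n, 'd) multi_index))"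
  have K: "K > 0"
    unfolding K_def by (simp add: card_gt_0_iff)
  have bound: "\<bar>form_eval h x\<bar> \<le> K * norm h" if x: "x \<in> ?S" for h :: "('n, 'd) form" and x
  proof -
    have "\<bar>x $ i\<bar> ^ k \<le> 1" for i k
      using component_le_norm_cart[of x i] x by (intro power_le_one) auto
    then have p: "(\<Prod>i\<in>UNIV. \<bar>x $ i\<bar> ^ exponent \<alpha> i) \<le> 1" for \<alpha> :: "('n, 'd) multi_index"
      by (intro prod_le_1) auto
    have "\<bar>form_eval h x\<bar> \<le> (\<Sum>\<alpha>\<in>UNIV. \<bar>h $ \<alpha>\<bar> * (\<Prod>i\<in>UNIV. \<bar>x $ i\<bar> ^ exponent \<alpha> i))"
      unfolding form_eval_def
      by (rule order_trans[OF sum_abs]) (simp add: abs_mult abs_prod power_abs)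
    also have "\<dots> \<le> (\<Sum>\<alpha>\<in>(UNIV :: ('n, 'd) multi_index set). norm h * 1)"
      using p component_le_norm_cart[of h] by (intro sum_mono mult_mono prod_nonneg) auto
    finally show ?thesis by (simp add: K_def)
  qed
  show "\<exists>e>0. \<forall>h. dist h g < e \<longrightarrow> h \<in> posdef_forms"
  proof (intro exI conjI allI impI)
    show "m / K > 0" using m K by simp
    fix h :: "('n, 'd) form"
    assume "dist h g < m / K"
    then have lt: "K * norm (h - g) < m"
      using K by (simp add: dist_norm field_simps)
    show "h \<in> posdef_forms"
      unfolding posdef_forms_def
    proof (intro CollectI allI impI)
      fix x :: "real ^ 'n"
      assume "x \<noteq> 0"
      define y where "y = (1 / norm x) *\<^sub>R x"
      have y: "y \<in> ?S" and x: "x = norm x *\<^sub>R y"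
        using \<open>x \<noteq> 0\<close> by (auto simp: y_def)
      have "form_eval h y = form_eval g y + form_eval (h - g) y"
        using form_eval_add[of g "h - g" y] by simp
      then have "form_eval h y > 0"
        using bound[OF y, of "h - g"] lt x0(2)[OF y] unfolding m_def by linarith
      then have "norm x ^ CARD('d) * form_eval h y > 0"
        using \<open>x \<noteq> 0\<close> by simp
      then show "form_eval h x > 0"
        by (metis x form_eval_homogeneous)
    qed
  qed
qed

end

theory Submission
  imports Defs
begin

text \<open>Layer cake: \<open>exp (- g x)\<close> is the integral of \<open>exp (- t)\<close> over \<open>t \<ge> g x\<close>. Exchanging the
  integrals over $x$ and $t$ leaves the volumes of the sublevel sets of $g$, which scale as
  \<open>t powr (n / d)\<close>, so that the integral of \<open>exp (- g x)\<close> is $\Gamma(1+n/d)$ times the volume of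
  \<open>sublevel g\<close>. Evaluation at $\ell$ is the Bombieri product with the Veronese form of $\ell$, whence
  the representation. Every form is bounded by a multiple of a positive definite one, so the integral
  of $h_1 \cdots h_k e^{-g}$ may be differentiated in $g$ under the integral sign; each derivative
  brings down a factor $-v$, which is nonpositive for positive definite $v$.\<close>

section \<open>Size estimates for forms\<close>

lemma continuous_on_form_eval [continuous_intros]:
  "continuous_on S (form_eval (g :: ('n::finite, 'd) form))"
  unfolding form_eval_def by (intro continuous_intros)

lemma borel_measurable_form_eval [measurable]:
  "form_eval (g :: ('n::finite, 'd) form) \<in> borel_measurable borel"
  by (intro borel_measurable_continuous_onI continuous_on_form_eval)

lemma form_eval_zero:
  assumes "CARD('d) > 0"
  shows "form_eval (g :: ('n::finite, 'd) form) 0 = 0"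
  using form_eval_homogeneous[of g 0 0] assms by (simp add: power_0_left)

lemma form_eval_nonneg:
  assumes "CARD('d) > 0" and "(g :: ('n::finite, 'd) form) \<in> posdef_forms"
  shows "form_eval g x \<ge> 0"
  using assms form_eval_zero[of g] by (cases "x = 0") (auto simp: posdef_forms_def less_imp_le)

lemma form_eval_le_norm:
  fixes h :: "('n::finite, 'd) form"
  shows "\<bar>form_eval h x\<bar> \<le> real CARD(('n, 'd) multi_index) * norm h * norm x ^ CARD('d)"
proof -
  have p: "(\<Prod>i\<in>UNIV. \<bar>x $ i\<bar> ^ exponent \<alpha> i) \<le> norm x ^ CARD('d)" for \<alpha> :: "('n, 'd) multi_index"
  proof -
    have "(\<Prod>i\<in>UNIV. \<bar>x $ i\<bar> ^ exponent \<alpha> i) \<le> (\<Prod>i\<in>UNIV. norm x ^ exponent \<alpha> i)"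
      by (intro prod_mono) (auto intro: power_mono component_le_norm_cart)
    then show ?thesis
      by (simp add: power_sum[symmetric] sum_exponent)
  qed
  have "\<bar>form_eval h x\<bar> \<le> (\<Sum>\<alpha>\<in>UNIV. \<bar>h $ \<alpha>\<bar> * (\<Prod>i\<in>UNIV. \<bar>x $ i\<bar> ^ exponent \<alpha> i))"
    unfolding form_eval_def
    by (rule order_trans[OF sum_abs]) (simp add: abs_mult abs_prod power_abs)
  also have "\<dots> \<le> (\<Sum>\<alpha>\<in>(UNIV :: ('n, 'd) multi_index set). norm h * norm x ^ CARD('d))"
    using p component_le_norm_cart[of h] by (intro sum_mono mult_mono prod_nonneg) auto
  finally show ?thesis by simp
qed

text \<open>The witness is the minimum of \<open>g\<close> on the unit sphere: it is attained by
  compactness, hence positive, and homogeneity spreads the bound to all of space.\<close>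

lemma posdef_forms_lower_bound:
  fixes g :: "('n::finite, 'd) form"
  assumes d: "CARD('d) > 0" and g: "g \<in> posdef_forms"
  obtains m where "m > 0" "\<And>x. m * norm x ^ CARD('d) \<le> form_eval g x"
proof -
  have "sphere (0 :: real ^ 'n) 1 \<noteq> {}"
    by simp
  then obtain z where z: "z \<in> sphere 0 1" "\<And>x. x \<in> sphere 0 1 \<Longrightarrow> form_eval g z \<le> form_eval g x"
    using continuous_attains_inf[OF compact_sphere _ continuous_on_form_eval] by blast
  show thesis
  proof
    have "z \<noteq> 0" using z(1) by auto
    then show "form_eval g z > 0"
      using g by (auto simp: posdef_forms_def)
    show "form_eval g z * norm x ^ CARD('d) \<le> form_eval g x" for x
    proof (cases "x = 0")
      case True
      then show ?thesis using d by (simp add: form_eval_zero power_0_left)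
    next
      case False
      have "form_eval g z * norm x ^ CARD('d) \<le> form_eval g ((1 / norm x) *\<^sub>R x) * norm x ^ CARD('d)"
        using False by (intro mult_right_mono z(2)) auto
      also have "\<dots> = form_eval g x"
        using False by (simp add: form_eval_homogeneous power_divide)
      finally show ?thesis .
    qed
  qed
qed

text \<open>Divides the upper bound for \<open>h\<close> by the lower bound for \<open>g\<close>,
  both multiples of \<open>norm x ^ CARD('d)\<close>. Since \<open>B\<close> is the same for all
  \<open>h\<close>, small perturbations of \<open>g\<close> are small relative to \<open>g\<close>
  at every point simultaneously.\<close>

lemma form_eval_le_posdef:
  fixes g :: "('n::finite, 'd) form"
  assumes d: "CARD('d) > 0" and g: "g \<in> posdef_forms"
  obtains B where "B > 0"
    "\<And>(h :: ('n, 'd) form) x. \<bar>form_eval h x\<bar> \<le> B * norm h * form_eval g x"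
proof -
  obtain m where m: "m > 0" "\<And>x. m * norm x ^ CARD('d) \<le> form_eval g x"
    using posdef_forms_lower_bound[OF d g] by blast
  define K where "K = real CARD(('n, 'd) multi_index)"
  have K: "K > 0"
    unfolding K_def by (simp add: card_gt_0_iff)
  show thesis
  proof
    show "K / m > 0" using K m by simp
    fix h :: "('n, 'd) form" and x
    have "norm x ^ CARD('d) \<le> form_eval g x / m"
      using m by (simp add: field_simps)
    then have "K * norm h * norm x ^ CARD('d) \<le> K * norm h * (form_eval g x / m)"
      using K by (intro mult_left_mono) auto
    then show "\<bar>form_eval h x\<bar> \<le> K / m * norm h * form_eval g x"
      using form_eval_le_norm[of h x] by (simp add: K_def)
  qed
qed

section \<open>Sublevel sets and their volumes\<close>

lemma compact_sublevel:
  fixes g :: "('n::finite, 'd) form"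
  assumes d: "CARD('d) > 0" and g: "g \<in> posdef_forms"
  shows "compact (sublevel g)"
proof -
  obtain m where m: "m > 0" "\<And>x. m * norm x ^ CARD('d) \<le> form_eval g x"
    using posdef_forms_lower_bound[OF d g] by blast
  \<comment> \<open>The maximum with 1 avoids a root: outside the unit ball, \<open>norm x\<close>
    is at most its own power, which is at most \<open>1 / m\<close> on the sublevel set.\<close>
  have "norm x \<le> max 1 (1 / m)" if "x \<in> sublevel g" for x
  proof (cases "norm x \<le> 1")
    case False
    then have "norm x ^ 1 \<le> norm x ^ CARD('d)"
      using d by (intro power_increasing) auto
    also have "\<dots> \<le> 1 / m"
      using m(1) order_trans[OF m(2), of x 1] that by (simp add: sublevel_def field_simps)
    finally show ?thesis by simp
  qed auto
  then have "bounded (sublevel g)"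
    unfolding bounded_iff by blast
  moreover have "closed (sublevel g)"
    unfolding sublevel_def by (intro closed_Collect_le continuous_intros)
  ultimately show ?thesis
    by (simp add: compact_eq_bounded_closed)
qed

text \<open>By homogeneity, dilation by the \<open>CARD('d)\<close>-th root \<open>c\<close> of
  \<open>t\<close> carries \<open>sublevel g\<close> onto the sublevel set at height
  \<open>t\<close>, and it multiplies Lebesgue measure by \<open>c ^ CARD('n)\<close>.\<close>

lemma emeasure_sublevel_scale:
  fixes g :: "('n::finite, 'd) form"
  assumes d: "CARD('d) > 0" and t: "t > 0"
  shows "emeasure lborel {x. form_eval g x \<le> t} =
    ennreal (t powr (real CARD('n) / real CARD('d))) * emeasure lborel (sublevel g)"
proof -
  define c where "c = t powr (1 / real CARD('d))"
  have c: "c > 0" "c ^ CARD('d) = t" "c ^ CARD('n) = t powr (real CARD('n) / real CARD('d))"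
    using t d by (simp_all add: c_def powr_powr flip: powr_realpow)
  let ?A = "{x. form_eval g x \<le> t}"
  have A [measurable]: "?A \<in> sets borel"
    by measurable
  have "(\<lambda>x. c *\<^sub>R x) -` ?A = sublevel g"
    using t by (auto simp: form_eval_homogeneous c(2) sublevel_def)
  moreover have "emeasure lborel ?A =
      emeasure (density (distr lborel borel (\<lambda>x. 0 + c *\<^sub>R x)) (\<lambda>_. \<bar>c\<bar> ^ DIM(real ^ 'n))) ?A"
    using lborel_affine[of c "0 :: real ^ 'n"] c(1) by simp
  ultimately show ?thesis
    using c(1,3) by (simp add: emeasure_density nn_integral_cmult emeasure_distr ennreal_power)
qed

section \<open>The Laplace integral of a positive definite form\<close>

lemma nn_integral_exp_tail: "(\<integral>\<^sup>+t. ennreal (exp (- t)) * indicator {a..} t \<partial>lborel) = ennreal (exp (- a))"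
proof -
  have "(\<integral>\<^sup>+t. ennreal (exp (- t)) * indicator {a..} t \<partial>lborel) = ennreal (0 - (- exp (- a)))"
  proof (rule nn_integral_FTC_atLeast)
    show "((\<lambda>t :: real. - exp (- t)) \<longlongrightarrow> 0) at_top"
      using tendsto_minus[OF filterlim_compose[OF exp_at_bot filterlim_uminus_at_bot_at_top]] by simp
  qed (auto intro!: derivative_eq_intros)
  then show ?thesis by simp
qed

lemma nn_integral_exp_form:
  fixes g :: "('n::finite, 'd) form"
  assumes d: "CARD('d) > 0" and g: "g \<in> posdef_forms"
  shows "(\<integral>\<^sup>+x. ennreal (exp (- form_eval g x)) \<partial>lborel) =
    ennreal (Gamma (1 + real CARD('n) / real CARD('d)) * sublevel_volume g)"
proof -
  define s where "s = 1 + real CARD('n) / real CARD('d)"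
  have s: "s > 0"
    using d by (simp add: s_def add_pos_nonneg)
  have "(\<integral>\<^sup>+x. ennreal (exp (- form_eval g x)) \<partial>lborel) =
      (\<integral>\<^sup>+x. (\<integral>\<^sup>+t. ennreal (exp (- t)) * indicator {form_eval g x..} t \<partial>lborel) \<partial>lborel)"
    by (simp add: nn_integral_exp_tail)
  \<comment> \<open>The indicator of a set depending on \<open>x\<close> becomes a conditional, so
    that joint measurability in \<open>x\<close> and \<open>t\<close> reduces to that of an
    inequality.\<close>
  also have "\<dots> = (\<integral>\<^sup>+x. (\<integral>\<^sup>+t. ennreal (exp (- t)) * (if form_eval g x \<le> t then 1 else 0) \<partial>lborel) \<partial>lborel)"
    by (auto intro!: nn_integral_cong split: split_indicator)
  also have "\<dots> = (\<integral>\<^sup>+t. (\<integral>\<^sup>+x. ennreal (exp (- t)) * (if form_eval g x \<le> t then 1 else 0) \<partial>lborel) \<partial>lborel)"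
    by (rule lborel_pair.Fubini'[symmetric]) measurable
  also have "\<dots> = (\<integral>\<^sup>+t. ennreal (exp (- t)) * emeasure lborel {x. form_eval g x \<le> t} \<partial>lborel)"
  proof (rule nn_integral_cong)
    fix t
    have "(\<integral>\<^sup>+x. ennreal (exp (- t)) * (if form_eval g x \<le> t then 1 else 0) \<partial>lborel) =
        (\<integral>\<^sup>+x. ennreal (exp (- t)) * indicator {x. form_eval g x \<le> t} x \<partial>lborel)"
      by (auto intro!: nn_integral_cong split: split_indicator)
    then show "(\<integral>\<^sup>+x. ennreal (exp (- t)) * (if form_eval g x \<le> t then 1 else 0) \<partial>lborel) =
        ennreal (exp (- t)) * emeasure lborel {x. form_eval g x \<le> t}"
      by (simp add: nn_integral_cmult_indicator)
  qed
  \<comment> \<open>This is the integrand of Euler's integral for \<open>Gamma s\<close>, as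
    \<open>s - 1\<close> is the scaling exponent.\<close>
  also have "\<dots> = (\<integral>\<^sup>+t. ennreal (indicator {0..} t * t powr (s - 1) / exp t) * emeasure lborel (sublevel g) \<partial>lborel)"
  \<comment> \<open>The null set \<open>t = 0\<close> is discarded: the scaling law covers
    \<open>t > 0\<close>, and for \<open>t < 0\<close> the sublevel set is empty because
    \<open>g\<close> is nonnegative.\<close>
  proof (rule nn_integral_cong_AE, rule AE_mp[OF AE_lborel_singleton[of 0]], rule AE_I2, rule impI)
    fix t :: real assume "t \<noteq> 0"
    show "ennreal (exp (- t)) * emeasure lborel {x. form_eval g x \<le> t} =
        ennreal (indicator {0..} t * t powr (s - 1) / exp t) * emeasure lborel (sublevel g)"
    proof (cases "t > 0")
      case True
      then have "indicator {0..} t * t powr (s - 1) / exp t = exp (- t) * t powr (s - 1)"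
        by (simp add: exp_minus field_simps)
      then show ?thesis
        by (simp only: emeasure_sublevel_scale[OF d True] ennreal_mult' exp_ge_zero mult.assoc)
          (simp add: s_def)
    next
      case False
      then have "\<not> form_eval g x \<le> t" for x
        using \<open>t \<noteq> 0\<close> form_eval_nonneg[OF d g, of x] by linarith
      then have "{x. form_eval g x \<le> t} = {}"
        by blast
      then show ?thesis using False \<open>t \<noteq> 0\<close> by simp
    qed
  qed
  also have "\<dots> = ennreal (Gamma s) * emeasure lborel (sublevel g)"
    by (simp add: nn_integral_multc Gamma_conv_nn_integral_real[OF s])
  also have "\<dots> = ennreal (Gamma s * sublevel_volume g)"
    using emeasure_compact_finite[OF compact_sublevel[OF d g]] Gamma_real_pos[OF s]
    by (simp add: sublevel_volume_def emeasure_eq_ennreal_measure ennreal_mult)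
  finally show ?thesis by (simp add: s_def)
qed

lemma has_bochner_integral_exp_form:
  fixes g :: "('n::finite, 'd) form"
  assumes d: "CARD('d) > 0" and g: "g \<in> posdef_forms"
  shows "has_bochner_integral lborel (\<lambda>x. exp (- form_eval g x))
    (Gamma (1 + real CARD('n) / real CARD('d)) * sublevel_volume g)"
proof (rule has_bochner_integral_nn_integral)
  have "Gamma (1 + real CARD('n) / real CARD('d)) > 0"
    by (intro Gamma_real_pos add_pos_nonneg) auto
  then show "0 \<le> Gamma (1 + real CARD('n) / real CARD('d)) * sublevel_volume g"
    by (simp add: sublevel_volume_def)
qed (auto simp: nn_integral_exp_form[OF d g])

section \<open>Moments and differentiation under the integral sign\<close>

lemma power_le_fact_exp:
  fixes u :: real
  assumes "u \<ge> 0"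
  shows "u ^ j \<le> fact j * exp u"
proof -
  have "(\<Sum>i\<in>{j}. u ^ i /\<^sub>R fact i) \<le> (\<Sum>i. u ^ i /\<^sub>R fact i)"
    using assms by (intro sum_le_suminf sums_summable[OF exp_converges]) auto
  then show ?thesis
    by (simp add: exp_def field_simps)
qed

text \<open>First-order Taylor remainder of the exponential at \<open>- u\<close>. The factor
  \<open>exp \<bar>u\<bar>\<close> will be absorbed by half of the decay of
  \<open>exp (- form_eval g x)\<close>.\<close>

lemma abs_exp_minus_le:
  fixes u :: real
  shows "\<bar>exp (- u) - 1 + u\<bar> \<le> exp \<bar>u\<bar> * u\<^sup>2"
  using Taylor_exp_field[of "- u" 1] by (simp add: power2_eq_square)

text \<open>On the positive definite cone these are, up to sign and the Gamma factor, the iterated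
  derivatives of the volume along \<open>hs\<close>. The entries are arbitrary forms, so that the
  family is closed under Frechet differentiation.\<close>

definition exp_moment :: "('n::finite, 'd) form list \<Rightarrow> ('n, 'd) form \<Rightarrow> real" where
  "exp_moment hs g = (LINT x|lborel. (\<Prod>h\<leftarrow>hs. form_eval h x) * exp (- form_eval g x))"

lemma borel_measurable_prod_list_form_eval [measurable]:
  "(\<lambda>x. \<Prod>h\<leftarrow>hs. form_eval (h :: ('n::finite, 'd) form) x) \<in> borel_measurable borel"
  by (induction hs) auto

lemma prod_list_form_eval_le:
  fixes g :: "('n::finite, 'd) form"
  assumes d: "CARD('d) > 0" and g: "g \<in> posdef_forms"
  obtains Q where "Q \<ge> 0" "\<And>x. \<bar>\<Prod>h\<leftarrow>hs. form_eval (h :: ('n, 'd) form) x\<bar> \<le> Q * form_eval g x ^ length hs"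
proof -
  obtain B where B: "B > 0" "\<And>(h :: ('n, 'd) form) x. \<bar>form_eval h x\<bar> \<le> B * norm h * form_eval g x"
    using form_eval_le_posdef[OF d g] by blast
  have "\<bar>\<Prod>h\<leftarrow>hs. form_eval h x\<bar> \<le> (\<Prod>h\<leftarrow>hs. B * norm h) * form_eval g x ^ length hs" for x
  proof (induction hs)
    case (Cons h hs)
    have "\<bar>form_eval h x\<bar> * \<bar>\<Prod>h\<leftarrow>hs. form_eval h x\<bar> \<le>
        (B * norm h * form_eval g x) * ((\<Prod>h\<leftarrow>hs. B * norm h) * form_eval g x ^ length hs)"
      using B form_eval_nonneg[OF d g] by (intro mult_mono Cons.IH) auto
    then show ?case by (simp add: abs_mult mult_ac)
  qed simp
  moreover have "(\<Prod>h\<leftarrow>hs. B * norm h) \<ge> 0"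
    using B(1) by (intro prod_list_nonneg) auto
  ultimately show thesis using that by blast
qed

text \<open>With \<open>u = form_eval g x / 4\<close> the integrand is
  \<open>4 ^ j * u ^ j * exp (- 2 * u)\<close>. One factor \<open>exp (- u)\<close> tames the power,
  and the other is integrable because \<open>g / 4\<close> is again positive definite. Only half of
  the exponent of \<open>exp (- form_eval g x)\<close> is spent here, leaving the rest for remainder
  terms.\<close>

lemma integrable_power_exp_form:
  fixes g :: "('n::finite, 'd) form"
  assumes d: "CARD('d) > 0" and g: "g \<in> posdef_forms"
  shows "integrable lborel (\<lambda>x. form_eval g x ^ j * exp (- form_eval g x / 2))"
proof (rule Bochner_Integration.integrable_bound)
  let ?g = "(1 / 4) *\<^sub>R g"
  have "?g \<in> posdef_forms"
    using g by (intro scaleR_posdef_forms) auto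
  then have "integrable lborel (\<lambda>x. exp (- form_eval ?g x))"
    using has_bochner_integral_exp_form[OF d] integrable.intros by blast
  then show "integrable lborel (\<lambda>x. 4 ^ j * fact j * exp (- form_eval ?g x))"
    by simp
  show "AE x in lborel. norm (form_eval g x ^ j * exp (- form_eval g x / 2)) \<le>
      norm (4 ^ j * fact j * exp (- form_eval ?g x))"
  proof (rule AE_I2)
    fix x
    define u where "u = form_eval g x / 4"
    have u: "u \<ge> 0" "form_eval g x = 4 * u" "form_eval ?g x = u"
      using form_eval_nonneg[OF d g, of x] by (simp_all add: u_def form_eval_scaleR)
    have "u ^ j * exp (- (2 * u)) \<le> fact j * exp u * exp (- (2 * u))"
      using power_le_fact_exp[OF u(1)] by (intro mult_right_mono) auto
    also have "\<dots> = fact j * exp (- u)"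
      unfolding mult.assoc exp_add[symmetric] by simp
    finally show "norm (form_eval g x ^ j * exp (- form_eval g x / 2)) \<le>
        norm (4 ^ j * fact j * exp (- form_eval ?g x))"
      unfolding u(2,3) using u(1) by (simp add: power_mult_distrib abs_mult)
  qed
qed measurable

lemma integrable_exp_moment:
  fixes g :: "('n::finite, 'd) form"
  assumes d: "CARD('d) > 0" and g: "g \<in> posdef_forms"
  shows "integrable lborel (\<lambda>x. (\<Prod>h\<leftarrow>hs. form_eval (h :: ('n, 'd) form) x) * exp (- form_eval g x))"
proof -
  obtain Q where Q: "Q \<ge> 0" "\<And>x. \<bar>\<Prod>h\<leftarrow>hs. form_eval (h :: ('n, 'd) form) x\<bar> \<le> Q * form_eval g x ^ length hs"
    using prod_list_form_eval_le[OF d g] by blast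
  show ?thesis
  proof (rule Bochner_Integration.integrable_bound)
    show "integrable lborel (\<lambda>x. Q * (form_eval g x ^ length hs * exp (- form_eval g x / 2)))"
      using integrable_power_exp_form[OF d g] by simp
    show "AE x in lborel. norm ((\<Prod>h\<leftarrow>hs. form_eval h x) * exp (- form_eval g x)) \<le>
        norm (Q * (form_eval g x ^ length hs * exp (- form_eval g x / 2)))"
    proof (rule AE_I2)
      fix x
      have "\<bar>\<Prod>h\<leftarrow>hs. form_eval h x\<bar> * exp (- form_eval g x) \<le>
          Q * form_eval g x ^ length hs * exp (- form_eval g x / 2)"
        using Q form_eval_nonneg[OF d g, of x] by (intro mult_mono) auto
      then show "norm ((\<Prod>h\<leftarrow>hs. form_eval h x) * exp (- form_eval g x)) \<le>
          norm (Q * (form_eval g x ^ length hs * exp (- form_eval g x / 2)))"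
        using Q form_eval_nonneg[OF d g, of x] by (simp add: abs_mult mult.assoc)
    qed
  qed measurable
qed

lemma has_derivative_quadratic_bound:
  fixes f :: "'a::euclidean_space \<Rightarrow> real"
  assumes "linear f'" and r: "r > 0"
    and bound: "\<And>h. norm h \<le> r \<Longrightarrow> \<bar>f (x + h) - f x - f' h\<bar> \<le> C * (norm h)\<^sup>2"
  shows "(f has_derivative f') (at x)"
  unfolding has_derivative_at_alt
proof (intro conjI allI impI)
  show "bounded_linear f'"
    using assms(1) by (rule linear_conv_bounded_linear[THEN iffD1])
  fix e :: real assume e: "e > 0"
  show "\<exists>\<delta>>0. \<forall>y. norm (y - x) < \<delta> \<longrightarrow> norm (f y - f x - f' (y - x)) \<le> e * norm (y - x)"
  proof (intro exI conjI allI impI)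
    \<comment> \<open>\<open>\<bar>C\<bar> + 1\<close> is a positive upper bound for
      \<open>C\<close>; within this radius one factor \<open>norm (y - x)\<close> turns the
      quadratic bound into a linear one with slope \<open>e\<close>.\<close>
    let ?\<delta> = "min r (e / (\<bar>C\<bar> + 1))"
    show "?\<delta> > 0" using r e by simp
    fix y assume y: "norm (y - x) < ?\<delta>"
    then have "norm (y - x) * (\<bar>C\<bar> + 1) < e"
      by (simp add: pos_less_divide_eq)
    moreover have "norm (y - x) * C \<le> norm (y - x) * (\<bar>C\<bar> + 1)"
      by (intro mult_left_mono) auto
    ultimately have "C * norm (y - x) * norm (y - x) \<le> e * norm (y - x)"
      by (intro mult_right_mono) (simp_all add: mult.commute)
    then show "norm (f y - f x - f' (y - x)) \<le> e * norm (y - x)"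
      using bound[of "y - x"] y by (simp add: power2_eq_square mult.assoc)
  qed
qed

text \<open>Expanding the exponential of the perturbation to first order under the integral leaves a
  remainder of at most \<open>(norm h)\<^sup>2\<close> times a fixed integrable weight. This gives
  the derivative directly from the quadratic criterion, with no limit theorem for integrals.\<close>

lemma has_derivative_exp_moment:
  fixes g :: "('n::finite, 'd) form"
  assumes d: "CARD('d) > 0" and g: "g \<in> posdef_forms"
  shows "(exp_moment hs has_derivative (\<lambda>h. - exp_moment (h # hs) g)) (at g)"
proof -
  obtain B where B: "B > 0" "\<And>(h :: ('n, 'd) form) x. \<bar>form_eval h x\<bar> \<le> B * norm h * form_eval g x"
    using form_eval_le_posdef[OF d g] by blast
  obtain Q where Q: "Q \<ge> 0" "\<And>x. \<bar>\<Prod>h\<leftarrow>hs. form_eval (h :: ('n, 'd) form) x\<bar> \<le> Q * form_eval g x ^ length hs"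
    using prod_list_form_eval_le[OF d g] by blast
  let ?P = "\<lambda>x. \<Prod>h\<leftarrow>hs. form_eval h x"
  \<comment> \<open>The exponent counts one factor \<open>form_eval g x\<close> for each entry of
    \<open>hs\<close> and two for the square in the Taylor remainder.\<close>
  let ?w = "\<lambda>x. form_eval g x ^ (length hs + 2) * exp (- form_eval g x / 2)"
  have w: "integrable lborel ?w"
    by (rule integrable_power_exp_form[OF d g])
  note int = integrable_exp_moment[OF d]
  show ?thesis
  \<comment> \<open>The radius forces
    \<open>\<bar>form_eval h x\<bar> \<le> form_eval g x / 2\<close>, which keeps
    \<open>g + h\<close> positive definite and leaves a decay of
    \<open>exp (- form_eval g x / 2)\<close>. In \<open>C\<close>, \<open>Q\<close> bounds the
    product over \<open>hs\<close> and \<open>B\<^sup>2\<close> comes from the squared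
    perturbation.\<close>
  proof (rule has_derivative_quadratic_bound[where r = "1 / (2 * B)" and C = "Q * B\<^sup>2 * (LINT x|lborel. ?w x)"])
    show "linear (\<lambda>h. - exp_moment (h # hs) g)"
    proof (rule linearI)
      fix a b :: "('n, 'd) form"
      show "- exp_moment ((a + b) # hs) g = - exp_moment (a # hs) g + - exp_moment (b # hs) g"
        using int[OF g, of "a # hs"] int[OF g, of "b # hs"]
        by (simp add: exp_moment_def form_eval_add distrib_right)
    next
      fix c :: real and a :: "('n, 'd) form"
      show "- exp_moment ((c *\<^sub>R a) # hs) g = c *\<^sub>R - exp_moment (a # hs) g"
        by (simp add: exp_moment_def form_eval_scaleR mult.assoc)
    qed
    show "1 / (2 * B) > 0" using B by simp
    fix h :: "('n, 'd) form"
    assume "norm h \<le> 1 / (2 * B)"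
    then have "B * norm h \<le> 1 / 2"
      using B(1) by (simp add: field_simps)
    then have small: "\<bar>form_eval h x\<bar> \<le> form_eval g x / 2" for x
      using mult_right_mono[OF _ form_eval_nonneg[OF d g, of x], of "B * norm h" "1 / 2"] B(2)[of h x]
      by linarith
    have gh: "g + h \<in> posdef_forms"
      unfolding posdef_forms_def
    proof (intro CollectI allI impI)
      fix x :: "real ^ 'n" assume "x \<noteq> 0"
      then have "form_eval g x > 0" using g by (simp add: posdef_forms_def)
      then show "form_eval (g + h) x > 0"
        using small[of x] by (simp add: form_eval_add)
    qed
    let ?R = "\<lambda>x. ?P x * exp (- form_eval (g + h) x) - ?P x * exp (- form_eval g x)
      + form_eval h x * ?P x * exp (- form_eval g x)"
    note ints = int[OF gh, of hs] int[OF g, of hs] int[OF g, of "h # hs", simplified]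
    have eq: "exp_moment hs (g + h) - exp_moment hs g - - exp_moment (h # hs) g = (LINT x|lborel. ?R x)"
      using ints by (simp add: exp_moment_def)
    have "\<bar>LINT x|lborel. ?R x\<bar> \<le> (LINT x|lborel. Q * B\<^sup>2 * (norm h)\<^sup>2 * ?w x)"
    proof (rule order_trans[OF integral_abs_bound], rule integral_mono)
      show "integrable lborel (\<lambda>x. \<bar>?R x\<bar>)"
        using ints by (intro integrable_abs) simp
      show "integrable lborel (\<lambda>x. Q * B\<^sup>2 * (norm h)\<^sup>2 * ?w x)"
        using w by simp
      fix x
      let ?u = "form_eval g x" and ?v = "form_eval h x"
      have u: "?u \<ge> 0" by (rule form_eval_nonneg[OF d g])
      have "?R x = ?P x * exp (- ?u) * (exp (- ?v) - 1 + ?v)"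
        unfolding form_eval_add minus_add_distrib exp_add by (simp add: algebra_simps)
      then have "\<bar>?R x\<bar> = \<bar>?P x\<bar> * exp (- ?u) * \<bar>exp (- ?v) - 1 + ?v\<bar>"
        by (simp add: abs_mult)
      also have "\<dots> \<le> (Q * ?u ^ length hs) * exp (- ?u) * (exp (?u / 2) * (B * norm h * ?u)\<^sup>2)"
      proof (intro mult_mono Q(2))
        have "exp \<bar>?v\<bar> * \<bar>?v\<bar>\<^sup>2 \<le> exp (?u / 2) * (B * norm h * ?u)\<^sup>2"
          using small B(2) by (intro mult_mono power_mono) auto
        then show "\<bar>exp (- ?v) - 1 + ?v\<bar> \<le> exp (?u / 2) * (B * norm h * ?u)\<^sup>2"
          using abs_exp_minus_le[of ?v] by simp
      qed (use Q(1) u in auto)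
      also have "\<dots> = Q * B\<^sup>2 * (norm h)\<^sup>2 * (?u ^ (length hs + 2) * exp (- ?u + ?u / 2))"
        unfolding exp_add
        by (simp only: power_mult_distrib power_add mult_ac)
      finally show "\<bar>?R x\<bar> \<le> Q * B\<^sup>2 * (norm h)\<^sup>2 * ?w x" by simp
    qed
    also have "\<dots> = (Q * B\<^sup>2 * (LINT x|lborel. ?w x)) * (norm h)\<^sup>2"
      by simp
    finally show "\<bar>exp_moment hs (g + h) - exp_moment hs g - - exp_moment (h # hs) g\<bar> \<le>
        (Q * B\<^sup>2 * (LINT x|lborel. ?w x)) * (norm h)\<^sup>2"
      unfolding eq .
  qed
qed

section \<open>Smoothness and iterated directional derivatives\<close>

text \<open>On an open set, functions that agree there have the same derivatives. This is needed
  because the volume is identified with a multiple of a moment on the cone only.\<close>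

lemma Ck_on_cong:
  assumes "open S"
  shows "(\<And>x. x \<in> S \<Longrightarrow> F x = G x) \<Longrightarrow> Ck_on k S F \<Longrightarrow> Ck_on k S G"
proof (induction k arbitrary: F G)
  case 0
  then show ?case by (simp cong: continuous_on_cong)
next
  case (Suc k)
  have G: "(G has_derivative frechet_derivative F (at x)) (at x)" if "x \<in> S" for x
    using has_derivative_transform_within_open[OF _ assms that Suc.prems(1)] Suc.prems(2) that
    by (simp add: frechet_derivative_works)
  have "frechet_derivative F (at x) v = frechet_derivative G (at x) v" if "x \<in> S" for x v
    using frechet_derivative_at[OF G[OF that]] by simp
  then have "Ck_on k S (\<lambda>x. frechet_derivative G (at x) v)" for v
    using Suc.IH[of "\<lambda>x. frechet_derivative F (at x) v"] Suc.prems(2) by simp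
  then show ?case
    using G by (auto simp: differentiable_def)
qed

text \<open>Differentiating along \<open>v\<close> prepends \<open>v\<close> to the list and flips
  the sign of the constant, so the induction must range over all \<open>c\<close> and
  \<open>hs\<close>.\<close>

lemma Ck_on_exp_moment:
  assumes d: "CARD('d) > 0"
  shows "Ck_on k posdef_forms (\<lambda>g. c * exp_moment (hs :: ('n::finite, 'd) form list) g)"
proof (induction k arbitrary: c hs)
  case 0
  have "isCont (exp_moment hs) g" if "g \<in> posdef_forms" for g
    using has_derivative_exp_moment[OF d that] by (rule has_derivative_continuous)
  then show ?case
    by (auto intro!: continuous_at_imp_continuous_on continuous_intros)
next
  case (Suc k)
  have D: "((\<lambda>g. c * exp_moment hs g) has_derivative (\<lambda>h. - c * exp_moment (h # hs) g)) (at g)"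
    if "g \<in> posdef_forms" for g
    using has_derivative_mult_right[OF has_derivative_exp_moment[OF d that, of hs], of c] by simp
  have "Ck_on k posdef_forms (\<lambda>g. frechet_derivative (\<lambda>g. c * exp_moment hs g) (at g) v)" for v
    by (rule Ck_on_cong[OF open_posdef_forms _ Suc.IH[of "- c" "v # hs"]])
      (simp add: frechet_derivative_at[OF D, symmetric])
  then show ?case
    using D by (auto simp: differentiable_def)
qed

lemma dir_deriv_eq:
  assumes "(F has_derivative F') (at x)"
  shows "dir_deriv v F x = F' v"
proof -
  have "((\<lambda>t :: real. x + t *\<^sub>R v) has_derivative (\<lambda>t. t *\<^sub>R v)) (at 0)"
    by (auto intro!: derivative_eq_intros)
  from has_derivative_compose[OF this, of F F'] assms
  have "((\<lambda>t. F (x + t *\<^sub>R v)) has_derivative (\<lambda>t. F' (t *\<^sub>R v))) (at 0)"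
    by simp
  also have "(\<lambda>t. F' (t *\<^sub>R v)) = (\<lambda>t. F' v * t)"
    by (simp add: linear_scale[OF has_derivative_linear[OF assms]] mult.commute)
  finally show ?thesis
    unfolding dir_deriv_def by (intro DERIV_imp_deriv) (simp add: has_field_derivative_def)
qed

text \<open>Each differentiation contributes a factor -1 and prepends its direction; the head of
  \<open>vs\<close> is the outermost derivative, so the list order matches that of
  \<open>exp_moment\<close>.\<close>

lemma dir_derivs_exp_moment:
  fixes g :: "('n::finite, 'd) form"
  assumes d: "CARD('d) > 0"
    and F: "\<And>g. g \<in> posdef_forms \<Longrightarrow> F g = c * exp_moment [] g"
  shows "g \<in> posdef_forms \<Longrightarrow> dir_derivs vs F g = (- 1) ^ length vs * c * exp_moment vs g"
proof (induction vs arbitrary: g)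
  case Nil
  then show ?case by (simp add: dir_derivs_def F)
next
  case (Cons v vs)
  let ?c = "(- 1) ^ length vs * c"
  have "((\<lambda>g. ?c * exp_moment vs g) has_derivative (\<lambda>h. ?c * - exp_moment (h # vs) g)) (at g)"
    by (intro has_derivative_mult_right has_derivative_exp_moment d Cons.prems)
  \<comment> \<open>The induction hypothesis gives equality on the whole cone, an open neighbourhood
    of \<open>g\<close>, so the derivative carries over.\<close>
  then have "(dir_derivs vs F has_derivative (\<lambda>h. ?c * - exp_moment (h # vs) g)) (at g)"
    by (rule has_derivative_transform_within_open[OF _ open_posdef_forms Cons.prems])
      (simp add: Cons.IH)
  from dir_deriv_eq[OF this, of v] show ?case
    by (simp add: dir_derivs_def)
qed

text \<open>Positivity of the directions enters here: it makes the integrand nonnegative. A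
  nonintegrable integrand would have integral 0 by convention, which is consistent with the bound
  for every \<open>g\<close>.\<close>

lemma exp_moment_nonneg:
  assumes "CARD('d) > 0" and "set vs \<subseteq> (posdef_forms :: ('n::finite, 'd) form set)"
  shows "exp_moment vs g \<ge> 0"
proof -
  have "(\<Prod>h\<leftarrow>vs. form_eval h x) \<ge> 0" for x
    using assms(2) form_eval_nonneg[OF assms(1)] by (intro prod_list_nonneg) auto
  then show ?thesis
    by (simp add: exp_moment_def)
qed

section \<open>The dual cone and the push-forward measure\<close>

lemma continuous_on_bombieri: "continuous_on S (\<lambda>\<theta>. bombieri \<theta> (g :: ('n::finite, 'd) form))"
  unfolding bombieri_def
  by (intro continuous_intros) (use multinomial_pos in \<open>force simp: less_le\<close>)

lemma borel_measurable_bombieri [measurable]: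
  "(\<lambda>\<theta>. bombieri \<theta> (g :: ('n::finite, 'd) form)) \<in> borel_measurable borel"
  by (intro borel_measurable_continuous_onI continuous_on_bombieri)

text \<open>The cone is an intersection of uncountably many half-spaces, so measurability is
  obtained from closedness.\<close>

lemma sets_borel_dual_cone [measurable]: "(dual_cone :: ('n::finite, 'd) form set) \<in> sets borel"
proof -
  have "dual_cone = (\<Inter>g\<in>(posdef_forms :: ('n, 'd) form set). {\<theta>. 0 \<le> bombieri \<theta> g})"
    by (auto simp: dual_cone_def)
  also have "closed \<dots>"
    by (intro closed_INT ballI closed_Collect_le continuous_on_bombieri continuous_on_const)
  finally show ?thesis by (rule borel_closed)
qed

lemma borel_measurable_veronese [measurable]:
  "(veronese :: real ^ 'n::finite \<Rightarrow> ('n, 'd) form) \<in> borel_measurable borel"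
  unfolding veronese_def
  by (intro borel_measurable_continuous_onI continuous_on_vec_lambda continuous_intros)

lemma veronese_in_dual_cone:
  assumes "CARD('d) > 0"
  shows "(veronese l :: ('n::finite, 'd) form) \<in> dual_cone"
  using form_eval_nonneg[OF assms] by (auto simp: dual_cone_def bombieri_veronese)

text \<open>Change of variables for the push-forward. The restriction to \<open>dual_cone\<close>
  disappears since the Veronese map takes all its values there.\<close>

lemma
  fixes f :: "('n::finite, 'd) form \<Rightarrow> real"
  assumes d: "CARD('d) > 0" and f [measurable]: "f \<in> borel_measurable borel"
  shows set_integrable_veronese_measure:
      "set_integrable veronese_measure dual_cone f \<longleftrightarrow> integrable lborel (\<lambda>x. f (veronese x))"
    and set_lebesgue_integral_veronese_measure:
      "(LINT \<theta>:dual_cone|veronese_measure. f \<theta>) = (LINT x|lborel. f (veronese x))"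
  unfolding set_integrable_def set_lebesgue_integral_def veronese_measure_def
  by (simp_all add: integrable_distr_eq integral_distr veronese_in_dual_cone[OF d])

theorem theorem1p1:
  assumes "CARD('n::finite) \<ge> 2"
    and "CARD('d) \<ge> 2"
    and "even (CARD('d))"
  shows "(\<forall>g\<in>(posdef_forms :: ('n, 'd) form set).
        emeasure lborel (sublevel g) < \<infinity> \<and>
        set_integrable veronese_measure dual_cone
          (\<lambda>\<theta>. exp (- bombieri \<theta> g) / Gamma (1 + real (CARD('n)) / real (CARD('d)))) \<and>
        sublevel_volume g =
          (LINT \<theta>:dual_cone|veronese_measure.
            exp (- bombieri \<theta> g) / Gamma (1 + real (CARD('n)) / real (CARD('d)))))
    \<and> completely_monotone_on (posdef_forms :: ('n, 'd) form set) sublevel_volume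
    \<and> (\<forall>vs. set vs \<subseteq> (posdef_forms :: ('n, 'd) form set) \<longrightarrow>
        (\<forall>g\<in>posdef_forms. (- 1) ^ length vs * dir_derivs vs sublevel_volume g \<ge> 0))"
proof -
  define \<Gamma> where "\<Gamma> = Gamma (1 + real (CARD('n)) / real (CARD('d)))"
  have d: "CARD('d) > 0" using assms(2) by simp
  have \<Gamma>: "\<Gamma> > 0"
    unfolding \<Gamma>_def by (intro Gamma_real_pos add_pos_nonneg) auto
  have int: "has_bochner_integral lborel (\<lambda>x. exp (- form_eval g x)) (\<Gamma> * sublevel_volume g)"
    if "g \<in> posdef_forms" for g :: "('n, 'd) form"
    using has_bochner_integral_exp_form[OF d that] by (simp add: \<Gamma>_def)
  have rep: "emeasure lborel (sublevel g) < \<infinity> \<and>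
      set_integrable veronese_measure dual_cone (\<lambda>\<theta>. exp (- bombieri \<theta> g) / \<Gamma>) \<and>
      sublevel_volume g = (LINT \<theta>:dual_cone|veronese_measure. exp (- bombieri \<theta> g) / \<Gamma>)"
    if g: "g \<in> posdef_forms" for g :: "('n, 'd) form"
    using emeasure_compact_finite[OF compact_sublevel[OF d g]] has_bochner_integral_iff[THEN iffD1, OF int[OF g]] \<Gamma>
    by (simp add: set_integrable_veronese_measure[OF d] set_lebesgue_integral_veronese_measure[OF d]
      bombieri_veronese)
  \<comment> \<open>The empty product is 1, so the moment of the empty list is the Laplace integral
    itself.\<close>
  have moment: "sublevel_volume g = inverse \<Gamma> * exp_moment [] g" if "g \<in> posdef_forms" for g :: "('n, 'd) form"
    using has_bochner_integral_integral_eq[OF int[OF that]] \<Gamma> by (simp add: exp_moment_def field_simps)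
  have mono: "(- 1) ^ length vs * dir_derivs vs sublevel_volume g \<ge> 0"
    if "set vs \<subseteq> posdef_forms" "g \<in> posdef_forms" for vs and g :: "('n, 'd) form"
  proof -
    \<comment> \<open>The sign from the iterated derivative cancels the alternating sign.\<close>
    have "(- 1) ^ length vs * dir_derivs vs sublevel_volume g = inverse \<Gamma> * exp_moment vs g"
      using dir_derivs_exp_moment[OF d moment that(2), of vs] by (simp add: power_mult_distrib[symmetric])
    then show ?thesis
      using exp_moment_nonneg[OF d that(1), of g] \<Gamma> by simp
  qed
  have "Ck_on k (posdef_forms :: ('n, 'd) form set) sublevel_volume" for k
    by (rule Ck_on_cong[OF open_posdef_forms _ Ck_on_exp_moment[OF d, of k "inverse \<Gamma>" "[]"]])
      (simp add: moment)
  then show ?thesis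
    unfolding completely_monotone_on_def \<Gamma>_def[symmetric] using rep mono by blast
qed

end
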